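(* Let $\succsim=(\succsim_1,\dots,\succsim_n)$ be a preference profile over objects and let $p$ be an assignment. The following are equivalent: (1) $p$ is possibly Pareto optimal with respect to $\succsim$; (2) there exists no directed cycle in $G(p)$ which contains at least one edge corresponding to a strict preference; (3) $p$ is Pareto optimal under lexicographic utilities consistent with $\succsim$.
   Context: $N=\{1,\dots,n\}$ is a set of agents and $O=\{o_1,\dots,o_m\}$ a set of objects. An assignment $p=(p(1),\dots,p(n))$ is a partition of $O$ into $n$ (possibly empty) subsets, $p(i)$ being the bundle of agent $i$. Each agent $i$ has a complete, transitive, reflexive preference relation $\succsim_i$ over $O$, with strict part $\succ_i$ and indifference part $\sim_i$. $\mathcal U(\succsim)$ is the set of utility profiles $u=(u_1,\dots,u_n)$ with $u_i:O\to\mathbb R_{>0}$ consistent with $\succsim_i$ (i.e. $u_i(o)\ge u_i(o')$ iff $o\succsim_i o'$), extended additively to bundles: $u_i(S)=\sum_{o\in S}u_i(o)$. For a given $u$, assignment $q$ Pareto dominates $p$ if $u_i(q(i))\ge u_i(p(i))$ for all $i$ and $u_i(q(i))>u_i(p(i))$ for some $i$; $p$ is Pareto optimal for $u$ if no assignment Pareto dominates it. $p$ is possibly Pareto optimal with respect to $\succsim$ if there exists $u\in\mathcal U(\succsim)$ such that $p$ is Pareto optimal for $u$. A profile $u\in\mathcal U(\succsim)$ is lexicographic if $u_i(o)>\sum_{o'\in O:\,o\succ_i o'}u_i(o')$ for every $i\in N$, $o\in O$ (empty sum $=0$). All lexicographic profiles in $\mathcal U(\succsim)$ induce the same comparisons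 of bundles for each agent, so condition (3) does not depend on which one is chosen. The directed graph $G(p)$ has vertex set $O$; for each object $o$, with $i$ the agent such that $o\in p(i)$, there is an edge $(o,o')$ for every $o'\in O\setminus\{o\}$ with $o'\succsim_i o$. The edge corresponds to a strict preference if $o'\succ_i o$. *)

theory Defs
  imports Complex_Main "HOL-Library.Disjoint_Sets" "Graph_Theory.Graph_Theory"
begin

text \<open>
  The agents are \<open>{1..n}\<close>, and \<open>Obj\<close> is the set of objects. A preference profile \<open>R\<close> assigns to
  every agent a relation as a set of pairs, where \<open>(a, b) \<in> R i\<close> means that agent \<open>i\<close> weakly
  prefers \<open>a\<close> to \<open>b\<close>: the preferred object comes first. Values of \<open>R\<close>, of assignments and of
  utility profiles at indices outside \<open>{1..n}\<close> play no role.
\<close>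

definition preference_profile :: "nat \<Rightarrow> 'a set \<Rightarrow> (nat \<Rightarrow> 'a rel) \<Rightarrow> bool" where
  "preference_profile n Obj R \<longleftrightarrow>
     (\<forall>i\<in>{1..n}. preorder_on Obj (R i) \<and> total_on Obj (R i))"

definition strict_pref :: "'a rel \<Rightarrow> 'a \<Rightarrow> 'a \<Rightarrow> bool" where
  "strict_pref r a b \<longleftrightarrow> (a, b) \<in> r \<and> (b, a) \<notin> r"

text \<open>
  Bundles may be empty, so \<^const>\<open>partition_on\<close>, which forbids empty blocks, is not used.
\<close>

definition assignment :: "nat \<Rightarrow> 'a set \<Rightarrow> (nat \<Rightarrow> 'a set) \<Rightarrow> bool" where
  "assignment n Obj p \<longleftrightarrow> (\<Union>i\<in>{1..n}. p i) = Obj \<and> disjoint_family_on p {1..n}"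

definition consistent_utilities ::
    "nat \<Rightarrow> 'a set \<Rightarrow> (nat \<Rightarrow> 'a rel) \<Rightarrow> (nat \<Rightarrow> 'a \<Rightarrow> real) \<Rightarrow> bool" where
  "consistent_utilities n Obj R u \<longleftrightarrow>
     (\<forall>i\<in>{1..n}. (\<forall>a\<in>Obj. u i a > 0) \<and>
        (\<forall>a\<in>Obj. \<forall>b\<in>Obj. u i a \<ge> u i b \<longleftrightarrow> (a, b) \<in> R i))"

definition bundle_utility :: "('a \<Rightarrow> real) \<Rightarrow> 'a set \<Rightarrow> real" where
  "bundle_utility v S = (\<Sum>a\<in>S. v a)"

definition pareto_dominates ::
    "nat \<Rightarrow> (nat \<Rightarrow> 'a \<Rightarrow> real) \<Rightarrow> (nat \<Rightarrow> 'a set) \<Rightarrow> (nat \<Rightarrow> 'a set) \<Rightarrow> bool" where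
  "pareto_dominates n u q p \<longleftrightarrow>
     (\<forall>i\<in>{1..n}. bundle_utility (u i) (q i) \<ge> bundle_utility (u i) (p i)) \<and>
     (\<exists>i\<in>{1..n}. bundle_utility (u i) (q i) > bundle_utility (u i) (p i))"

definition pareto_optimal ::
    "nat \<Rightarrow> 'a set \<Rightarrow> (nat \<Rightarrow> 'a \<Rightarrow> real) \<Rightarrow> (nat \<Rightarrow> 'a set) \<Rightarrow> bool" where
  "pareto_optimal n Obj u p \<longleftrightarrow> \<not> (\<exists>q. assignment n Obj q \<and> pareto_dominates n u q p)"

definition possibly_pareto_optimal ::
    "nat \<Rightarrow> 'a set \<Rightarrow> (nat \<Rightarrow> 'a rel) \<Rightarrow> (nat \<Rightarrow> 'a set) \<Rightarrow> bool" where
  "possibly_pareto_optimal n Obj R p \<longleftrightarrow>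
     (\<exists>u. consistent_utilities n Obj R u \<and> pareto_optimal n Obj u p)"

definition lexicographic_utilities ::
    "nat \<Rightarrow> 'a set \<Rightarrow> (nat \<Rightarrow> 'a rel) \<Rightarrow> (nat \<Rightarrow> 'a \<Rightarrow> real) \<Rightarrow> bool" where
  "lexicographic_utilities n Obj R u \<longleftrightarrow>
     consistent_utilities n Obj R u \<and>
     (\<forall>i\<in>{1..n}. \<forall>a\<in>Obj. u i a > (\<Sum>b\<in>{b\<in>Obj. strict_pref (R i) a b}. u i b))"

definition exchange_graph ::
    "nat \<Rightarrow> 'a set \<Rightarrow> (nat \<Rightarrow> 'a rel) \<Rightarrow> (nat \<Rightarrow> 'a set) \<Rightarrow> 'a pair_pre_digraph" where
  "exchange_graph n Obj R p =
     \<lparr> pverts = Obj,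
       parcs = {(a, b). \<exists>i\<in>{1..n}. a \<in> p i \<and> b \<in> Obj - {a} \<and> (b, a) \<in> R i} \<rparr>"

definition strict_edge ::
    "nat \<Rightarrow> (nat \<Rightarrow> 'a rel) \<Rightarrow> (nat \<Rightarrow> 'a set) \<Rightarrow> 'a \<times> 'a \<Rightarrow> bool" where
  "strict_edge n R p e \<longleftrightarrow> (\<exists>i\<in>{1..n}. fst e \<in> p i \<and> strict_pref (R i) (snd e) (fst e))"

text \<open>
  A \<^const>\<open>pre_digraph.cycle\<close> is given by its list of arcs and repeats no vertex. It could be a
  loop, but \<^const>\<open>exchange_graph\<close> has none.
\<close>

definition has_strict_cycle ::
    "nat \<Rightarrow> 'a set \<Rightarrow> (nat \<Rightarrow> 'a rel) \<Rightarrow> (nat \<Rightarrow> 'a set) \<Rightarrow> bool" where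
  "has_strict_cycle n Obj R p \<longleftrightarrow>
     (\<exists>c. pre_digraph.cycle (with_proj (exchange_graph n Obj R p)) c \<and>
          (\<exists>e\<in>set c. strict_edge n R p e))"

end

theory Submission
  imports Defs "HOL-Combinatorics.Permutations"
begin

text \<open>
  A strict cycle is a trading cycle: rotating its objects along the edges improves the owner of the
  tail of a strict edge under every consistent utility profile and harms nobody. Conversely, let
  \<open>q\<close> dominate \<open>p\<close> under lexicographic utilities and differ from \<open>p\<close> in as few objects as possible.
  An agent of \<open>p\<close> who loses an object gains one that is at least as good, since otherwise
  everything gained is jointly worth less than that single object. Following these replacements from
  one moved object to the next yields a cycle of the exchange graph. If none of its edges is strict,
  then undoing the corresponding moves in \<open>q\<close> changes no utility, so \<open>q\<close> was not minimal.
\<close>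

section \<open>Cycles and permutations\<close>

lemma cas_with_proj_iff:
  "pre_digraph.cas (with_proj G) u c v \<longleftrightarrow> map fst c @ [v] = u # map snd c"
  by (induction c arbitrary: u) (auto simp: pre_digraph.cas.simps)

text \<open>In a closed walk the heads are the tails rotated by one place. The distinctness required
  by \<open>cycle\<close> concerns the heads, so it carries over to the tails, and a cycle can be
  read as a finite map from tails to heads.\<close>

lemma cycle_with_proj_iff:
  "pre_digraph.cycle (with_proj G) c \<longleftrightarrow>
     c \<noteq> [] \<and> fst (hd c) \<in> pverts G \<and> set c \<subseteq> parcs G \<and>
     map snd c = rotate1 (map fst c) \<and> distinct (map fst c)"
proof (cases c)
  case Nil
  then show ?thesis by (simp add: pre_digraph.cycle_def)
next
  case (Cons e es)
  have "pre_digraph.awalk (with_proj G) u c u \<longleftrightarrow>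
      u = fst e \<and> fst e \<in> pverts G \<and> set c \<subseteq> parcs G \<and> map snd c = rotate1 (map fst c)" for u
    unfolding pre_digraph.awalk_def cas_with_proj_iff by (auto simp: Cons)
  moreover have "distinct (tl (pre_digraph.awalk_verts (with_proj G) (fst e) c)) \<longleftrightarrow>
      distinct (map fst c)" if "map snd c = rotate1 (map fst c)"
  proof -
    have "pre_digraph.cas (with_proj G) (fst e) c (fst e)"
      using that by (simp add: cas_with_proj_iff Cons)
    from pre_digraph.awalk_verts_conv'[OF this]
    have "tl (pre_digraph.awalk_verts (with_proj G) (fst e) c) = map snd c"
      by (simp add: Cons)
    then show ?thesis using that by (metis distinct1_rotate)
  qed
  ultimately show ?thesis
    unfolding pre_digraph.cycle_def by (auto simp: Cons)
qed

text \<open>Rotation preserves both the set and the distinctness of \<open>xs\<close>, so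
  \<open>f\<close> is onto and injective there. This turns cycles into permutations of objects in
  both directions of the proof.\<close>

lemma permutes_of_rotate1:
  assumes "map f xs = rotate1 xs" "distinct xs" "\<And>a. a \<notin> set xs \<Longrightarrow> f a = a"
  shows "f permutes set xs"
proof (rule bij_imp_permutes)
  have "f ` set xs = set xs"
    using arg_cong[OF assms(1), of set] by simp
  moreover have "inj_on f (set xs)"
    using assms(1,2) by (metis distinct1_rotate distinct_map)
  ultimately show "bij_betw f (set xs) (set xs)"
    by (simp add: bij_betw_def)
qed (use assms(3) in auto)

text \<open>By the pigeonhole principle an orbit revisits a point; the iterates of such a point over
  its least period form the list.\<close>

lemma finite_self_map_has_cycle:
  assumes "finite D" "D \<noteq> {}" "f ` D \<subseteq> D"
  obtains xs where "xs \<noteq> []" "distinct xs" "set xs \<subseteq> D" "map f xs = rotate1 xs"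
proof -
  obtain y where y: "y \<in> D" using assms(2) by blast
  have orbit: "(f ^^ k) z \<in> D" if "z \<in> D" for k z
    using that assms(3) by (induction k) auto
  have "\<not> inj (\<lambda>k. (f ^^ k) y)"
  proof
    assume "inj (\<lambda>k. (f ^^ k) y)"
    moreover have "finite (range (\<lambda>k. (f ^^ k) y))"
      using orbit[OF y] by (intro finite_subset[OF _ assms(1)]) auto
    ultimately show False
      using finite_imageD infinite_UNIV_nat by blast
  qed
  then obtain i j where ij: "i < j" "(f ^^ i) y = (f ^^ j) y"
    unfolding inj_def by (metis linorder_neqE_nat)
  define x where "x = (f ^^ i) y"
  have x: "x \<in> D" using orbit[OF y] by (simp add: x_def)
  have per: "(f ^^ (j - i)) x = x"
  proof -
    have "(f ^^ (j - i)) x = (f ^^ (j - i + i)) y"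
      by (simp only: x_def funpow_add comp_apply)
    then show ?thesis using ij by (simp add: x_def)
  qed
  define k where "k = (LEAST k. 0 < k \<and> (f ^^ k) x = x)"
  have k: "0 < k" "(f ^^ k) x = x"
    using LeastI[of "\<lambda>k. 0 < k \<and> (f ^^ k) x = x" "j - i"] per ij(1)
    by (simp_all add: k_def)
  have k_least: "k \<le> m" if "0 < m" "(f ^^ m) x = x" for m
    unfolding k_def by (rule Least_le) (use that in simp)
  \<comment> \<open>Applying \<open>f\<close> another \<open>k - b\<close> times to an equality
    would return \<open>x\<close> to itself after \<open>k - b + a\<close> steps, fewer than the
    least period \<open>k\<close>.\<close>
  have neq: "(f ^^ a) x \<noteq> (f ^^ b) x" if "a < b" "b < k" for a b
  proof
    assume "(f ^^ a) x = (f ^^ b) x"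
    then have "(f ^^ (k - b + a)) x = (f ^^ (k - b + b)) x"
      by (simp only: funpow_add comp_apply)
    then have "(f ^^ (k - b + a)) x = x"
      using that k(2) by simp
    then have "k \<le> k - b + a"
      using that by (intro k_least) simp_all
    then show False using that by simp
  qed
  define xs where "xs = map (\<lambda>m. (f ^^ m) x) [0..<k]"
  show thesis
  proof (rule that)
    show "xs \<noteq> []" using k by (simp add: xs_def)
    show "distinct xs"
      unfolding xs_def distinct_map by (auto intro!: linorder_inj_onI' dest: neq)
    show "set xs \<subseteq> D" using orbit[OF x] by (auto simp: xs_def)
    show "map f xs = rotate1 xs"
    proof (rule nth_equalityI)
      fix m assume "m < length (map f xs)"
      then have m: "m < k" by (simp add: xs_def)
      show "map f xs ! m = rotate1 xs ! m"
        using m k by (cases "Suc m = k") (auto simp: xs_def nth_rotate1)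
    qed simp
  qed
qed

section \<open>The exchange graph\<close>

lemma assignment_owner_unique:
  assumes "assignment n Obj p" "i \<in> {1..n}" "j \<in> {1..n}" "a \<in> p i" "a \<in> p j"
  shows "i = j"
  using assms unfolding assignment_def disjoint_family_on_def by blast

text \<open>Every object on the cycle is sent to the head of its outgoing edge, every other object
  to itself; \<open>f a\<close> is what the owner of \<open>a\<close> receives in exchange for
  \<open>a\<close>.\<close>

lemma strict_cycle_permutation:
  assumes "has_strict_cycle n Obj R p"
    and "assignment n Obj p"
    and "preference_profile n Obj R"
  obtains f where "f permutes Obj"
    and "\<And>i a. i \<in> {1..n} \<Longrightarrow> a \<in> p i \<Longrightarrow> (f a, a) \<in> R i"
    and "\<exists>i\<in>{1..n}. \<exists>a\<in>p i. strict_pref (R i) (f a) a"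
proof -
  obtain c e where c: "set c \<subseteq> parcs (exchange_graph n Obj R p)"
    "map snd c = rotate1 (map fst c)" "distinct (map fst c)"
    and e: "e \<in> set c" "strict_edge n R p e"
    using assms(1) unfolding has_strict_cycle_def cycle_with_proj_iff by blast
  define f where "f a = (case map_of c a of None \<Rightarrow> a | Some b \<Rightarrow> b)" for a
  have f_arc: "f a = b" if "(a, b) \<in> set c" for a b
    using that c(3) by (simp add: f_def)
  have "map f (map fst c) = map snd c"
    using f_arc by auto
  moreover have "f a = a" if "a \<notin> set (map fst c)" for a
    using that map_of_eq_None_iff[of c a] by (simp add: f_def)
  ultimately have "f permutes set (map fst c)"
    using c by (intro permutes_of_rotate1) auto
  moreover have "set (map fst c) \<subseteq> Obj"
    using c(1) assms(2) by (force simp: exchange_graph_def assignment_def)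
  ultimately have "f permutes Obj" by (rule permutes_subset)
  moreover have "(f a, a) \<in> R i" if "i \<in> {1..n}" "a \<in> p i" for i a
  proof (cases "map_of c a")
    case None
    have "a \<in> Obj" using that assms(2) by (auto simp: assignment_def)
    then show ?thesis
      using assms(3) that None by (auto simp: preference_profile_def preorder_on_def refl_on_def f_def)
  next
    case (Some b)
    then have "(a, b) \<in> parcs (exchange_graph n Obj R p)"
      using c(1) map_of_SomeD by fast
    then obtain j where j: "j \<in> {1..n}" "a \<in> p j" "(b, a) \<in> R j"
      by (auto simp: exchange_graph_def)
    \<comment> \<open>The edge only says that some owner of \<open>a\<close> weakly prefers
      \<open>b\<close>; bundles are disjoint, so that owner is \<open>i\<close>.\<close>
    have "j = i"
      using assignment_owner_unique[OF assms(2)] j that by blast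
    then show ?thesis using j Some by (simp add: f_def)
  qed
  moreover have "\<exists>i\<in>{1..n}. \<exists>a\<in>p i. strict_pref (R i) (f a) a"
    using e f_arc[of "fst e" "snd e"] unfolding strict_edge_def by (metis prod.collapse)
  ultimately show thesis using that by blast
qed

text \<open>The cycle consists of the edges from \<open>a\<close> to \<open>f a\<close>. Since the
  graph has no loops, \<open>f\<close> must move every object of the list.\<close>

lemma has_strict_cycleI:
  assumes "xs \<noteq> []" "distinct xs" "map f xs = rotate1 xs" "set xs \<subseteq> Obj"
    and "\<And>a. a \<in> set xs \<Longrightarrow> \<exists>i\<in>{1..n}. a \<in> p i \<and> f a \<noteq> a \<and> (f a, a) \<in> R i"
    and "\<exists>a\<in>set xs. \<exists>i\<in>{1..n}. a \<in> p i \<and> strict_pref (R i) (f a) a"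
  shows "has_strict_cycle n Obj R p"
proof -
  let ?c = "map (\<lambda>a. (a, f a)) xs"
  have "f a \<in> Obj" if "a \<in> set xs" for a
    using that assms(4) arg_cong[OF assms(3), of set] by auto
  then have "pre_digraph.cycle (with_proj (exchange_graph n Obj R p)) ?c"
    using assms(1-5)
    by (fastforce simp: cycle_with_proj_iff exchange_graph_def comp_def list.map_sel)
  moreover have "\<exists>e\<in>set ?c. strict_edge n R p e"
    using assms(6) by (auto simp: strict_edge_def)
  ultimately show ?thesis unfolding has_strict_cycle_def by blast
qed

section \<open>Assignments and utilities\<close>

lemma assignment_permutes:
  assumes "assignment n Obj p" "f permutes Obj"
  shows "assignment n Obj (\<lambda>i. f ` p i)"
proof -
  have "(\<Union>i\<in>{1..n}. f ` p i) = f ` Obj"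
    using assms(1) by (auto simp: assignment_def)
  moreover have "disjoint_family_on (\<lambda>i. f ` p i) {1..n}"
    using assms unfolding assignment_def disjoint_family_on_def
    by (metis image_Int image_empty permutes_inj)
  ultimately show ?thesis
    using assms(2) by (simp add: assignment_def permutes_image)
qed

lemma bundle_utility_permutes:
  "f permutes Obj \<Longrightarrow> bundle_utility v (f ` S) = (\<Sum>a\<in>S. v (f a))"
  unfolding bundle_utility_def by (simp add: sum.reindex permutes_inj_on)

section \<open>Trading along a strict cycle\<close>

lemma strict_cycle_not_pareto_optimal:
  assumes "finite Obj" "preference_profile n Obj R" "assignment n Obj p"
    and "has_strict_cycle n Obj R p" "consistent_utilities n Obj R u"
  shows "\<not> pareto_optimal n Obj u p"
proof -
  obtain f where f: "f permutes Obj"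
    and weak: "\<And>i a. i \<in> {1..n} \<Longrightarrow> a \<in> p i \<Longrightarrow> (f a, a) \<in> R i"
    and "\<exists>i\<in>{1..n}. \<exists>a\<in>p i. strict_pref (R i) (f a) a"
    using strict_cycle_permutation[OF assms(4,3,2)] by blast
  then obtain i a where i: "i \<in> {1..n}" "a \<in> p i" "strict_pref (R i) (f a) a"
    by blast
  have sub: "p j \<subseteq> Obj" if "j \<in> {1..n}" for j
    using assms(3) that by (auto simp: assignment_def)
  have u_iff: "u j (f b) \<ge> u j c \<longleftrightarrow> (f b, c) \<in> R j" "u j c \<ge> u j (f b) \<longleftrightarrow> (c, f b) \<in> R j"
    if "j \<in> {1..n}" "b \<in> p j" "c \<in> p j" for j b c
  proof -
    have "f b \<in> Obj" "c \<in> Obj"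
      using that sub[OF that(1)] permutes_in_image[OF f] by auto
    then show "u j (f b) \<ge> u j c \<longleftrightarrow> (f b, c) \<in> R j" "u j c \<ge> u j (f b) \<longleftrightarrow> (c, f b) \<in> R j"
      using that(1) assms(5) unfolding consistent_utilities_def by blast+
  qed
  have le: "u j (f b) \<ge> u j b" if "j \<in> {1..n}" "b \<in> p j" for j b
    using u_iff that weak by blast
  have fin: "finite (p j)" if "j \<in> {1..n}" for j
    using sub[OF that] assms(1) finite_subset by blast
  have "bundle_utility (u j) (f ` p j) \<ge> bundle_utility (u j) (p j)" if "j \<in> {1..n}" for j
    unfolding bundle_utility_permutes[OF f]
    using le[OF that] by (auto simp: bundle_utility_def intro!: sum_mono)
  moreover have "bundle_utility (u i) (f ` p i) > bundle_utility (u i) (p i)"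
    unfolding bundle_utility_permutes[OF f] unfolding bundle_utility_def
  proof (rule sum_strict_mono_ex1)
    have "u i a < u i (f a)"
      using i u_iff(2)[OF i(1,2,2)] by (auto simp: strict_pref_def not_le[symmetric])
    then show "\<exists>b\<in>p i. u i b < u i (f b)" using i by blast
  qed (use fin le i in auto)
  ultimately have "pareto_dominates n u (\<lambda>i. f ` p i) p"
    using i(1) by (auto simp: pareto_dominates_def)
  then show ?thesis
    using assignment_permutes[OF assms(3) f] by (auto simp: pareto_optimal_def)
qed

section \<open>Domination under lexicographic utilities\<close>

text \<open>Otherwise totality makes everything in \<open>T - S\<close> strictly worse than
  \<open>a\<close>, hence jointly worth less than \<open>a\<close> alone, which lies in
  \<open>S - T\<close>. Adding the common part \<open>S \<inter> T\<close> then contradicts the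
  comparison of \<open>S\<close> and \<open>T\<close>.\<close>

lemma lexicographic_replacement:
  assumes "finite Obj" "preference_profile n Obj R" "lexicographic_utilities n Obj R u"
    and "i \<in> {1..n}" "S \<subseteq> Obj" "T \<subseteq> Obj" "bundle_utility (u i) S \<le> bundle_utility (u i) T"
    and "a \<in> S - T"
  obtains b where "b \<in> T - S" "(b, a) \<in> R i"
proof (rule ccontr)
  assume "\<not> thesis"
  with that have none: "(b, a) \<notin> R i" if "b \<in> T - S" for b using \<open>b \<in> T - S\<close> by blast
  have fin: "finite S" "finite T" using assms(1,5,6) finite_subset by blast+
  have pos: "u i b > 0" if "b \<in> Obj" for b
    using assms(3,4) that by (auto simp: lexicographic_utilities_def consistent_utilities_def)
  have worse: "strict_pref (R i) a b" if "b \<in> T - S" for b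
  proof -
    have "a \<in> Obj" "b \<in> Obj" "a \<noteq> b" using that assms(5,6,8) by auto
    then show ?thesis
      using none[OF that] assms(2,4)
      unfolding preference_profile_def total_on_def strict_pref_def by blast
  qed
  have "(\<Sum>b\<in>T - S. u i b) \<le> (\<Sum>b\<in>{b\<in>Obj. strict_pref (R i) a b}. u i b)"
    using assms(1,6) worse pos by (intro sum_mono2) (auto intro: less_imp_le)
  also have "\<dots> < u i a"
    using assms(3,4,5,8) unfolding lexicographic_utilities_def by blast
  also have "u i a \<le> (\<Sum>b\<in>S - T. u i b)"
    using assms(5,8) fin pos by (intro member_le_sum) (auto intro: less_imp_le)
  finally have "sum (u i) (T - S) < sum (u i) (S - T)" .
  moreover have "sum (u i) S = sum (u i) (S \<inter> T) + sum (u i) (S - T)"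
    using fin by (simp add: sum.Int_Diff)
  moreover have "sum (u i) T = sum (u i) (S \<inter> T) + sum (u i) (T - S)"
    using sum.Int_Diff[OF fin(2), of "u i" S] by (simp add: Int_commute)
  ultimately show False
    using assms(7) by (simp add: bundle_utility_def)
qed

text \<open>Induction on the number of objects that their owners under \<open>p\<close> lose in
  \<open>q\<close>: a dominating \<open>q\<close> yields another dominating assignment with fewer
  such objects.\<close>

lemma no_strict_cycle_not_dominated:
  assumes "finite Obj" "preference_profile n Obj R" "assignment n Obj p"
    and "\<not> has_strict_cycle n Obj R p" "lexicographic_utilities n Obj R u"
    and "assignment n Obj q"
  shows "\<not> pareto_dominates n u q p"
  using assms(6)
proof (induction "card (\<Union>i\<in>{1..n}. p i - q i)" arbitrary: q rule: less_induct)
  case less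
  define D where "D = (\<Union>i\<in>{1..n}. p i - q i)"
  have p_sub: "p i \<subseteq> Obj" and q_sub: "q i \<subseteq> Obj" if "i \<in> {1..n}" for i
    using assms(3) less.prems that by (auto simp: assignment_def)
  note p_unique = assignment_owner_unique[OF assms(3)]
  note q_unique = assignment_owner_unique[OF less.prems]
  have D_sub: "D \<subseteq> Obj" using p_sub unfolding D_def by blast
  have finD: "finite D" using D_sub assms(1) finite_subset by blast
  show ?case
  proof
    assume dom: "pareto_dominates n u q p"
    have "D \<noteq> {}"
    proof
      assume "D = {}"
      \<comment> \<open>If nobody loses an object, then nobody gains one either, as both assignments
        distribute the same objects; a strict improvement is then impossible.\<close>
      then have *: "p i \<subseteq> q i" if "i \<in> {1..n}" for i using that by (auto simp: D_def)
      have "q i \<subseteq> p i" if i: "i \<in> {1..n}" for i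
      proof
        fix a assume a: "a \<in> q i"
        then obtain j where "j \<in> {1..n}" "a \<in> p j"
          using q_sub[OF i] assms(3) by (auto simp: assignment_def)
        then show "a \<in> p i" using * q_unique i a by blast
      qed
      then have "q i = p i" if "i \<in> {1..n}" for i using * that by blast
      then show False using dom by (auto simp: pareto_dominates_def)
    qed
    \<comment> \<open>The replacement \<open>b\<close> that the owner of \<open>a\<close> gains was
      itself lost by its owner under \<open>p\<close>, so it lies in \<open>D\<close> again.
      Choosing such a \<open>b\<close> for each \<open>a\<close> gives a self-map of
      \<open>D\<close>.\<close>
    have "\<exists>b. b \<in> D \<and> (\<forall>i\<in>{1..n}. a \<in> p i \<longrightarrow> b \<in> q i - p i \<and> (b, a) \<in> R i)" if "a \<in> D" for a
    proof -
      obtain i where i: "i \<in> {1..n}" "a \<in> p i - q i" using \<open>a \<in> D\<close> unfolding D_def by blast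
      have "bundle_utility (u i) (p i) \<le> bundle_utility (u i) (q i)"
        using dom i by (auto simp: pareto_dominates_def)
      then obtain b where b: "b \<in> q i - p i" "(b, a) \<in> R i"
        using lexicographic_replacement[OF assms(1,2,5) i(1) p_sub[OF i(1)] q_sub[OF i(1)]] i(2)
        by blast
      then obtain j where j: "j \<in> {1..n}" "b \<in> p j"
        using q_sub[OF i(1)] assms(3) by (auto simp: assignment_def)
      have "b \<notin> q j" using b(1) j q_unique[OF i(1) j(1), of b] by blast
      then have "b \<in> D" using j unfolding D_def by blast
      then show ?thesis using b i p_unique by blast
    qed
    then obtain f where f_in: "\<And>a. a \<in> D \<Longrightarrow> f a \<in> D"
      and f: "\<And>a i. a \<in> D \<Longrightarrow> i \<in> {1..n} \<Longrightarrow> a \<in> p i \<Longrightarrow> f a \<in> q i - p i \<and> (f a, a) \<in> R i"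
      by metis
    obtain xs where xs: "xs \<noteq> []" "distinct xs" "set xs \<subseteq> D" "map f xs = rotate1 xs"
      using finite_self_map_has_cycle[OF finD \<open>D \<noteq> {}\<close>, of f] f_in by blast
    have owner: "\<exists>i\<in>{1..n}. a \<in> p i" if "a \<in> set xs" for a
      using that xs(3) by (auto simp: D_def)
    have not_strict: "\<not> strict_pref (R i) (f a) a"
      if "a \<in> set xs" "i \<in> {1..n}" "a \<in> p i" for a i
    proof
      assume "strict_pref (R i) (f a) a"
      then have "\<exists>a\<in>set xs. \<exists>i\<in>{1..n}. a \<in> p i \<and> strict_pref (R i) (f a) a"
        using that by blast
      moreover have "\<exists>i\<in>{1..n}. b \<in> p i \<and> f b \<noteq> b \<and> (f b, b) \<in> R i" if b: "b \<in> set xs" for b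
      proof -
        obtain j where j: "j \<in> {1..n}" "b \<in> p j" using owner[OF b] by blast
        have "f b \<in> q j - p j" "(f b, b) \<in> R j" using f[of b j] b j xs(3) by auto
        then show ?thesis using j by (intro bexI[of _ j]) auto
      qed
      ultimately have "has_strict_cycle n Obj R p"
        using xs D_sub by (intro has_strict_cycleI[of xs f]) auto
      then show False using assms(4) by simp
    qed
    have indiff: "u i (f a) = u i a" if "a \<in> set xs" "i \<in> {1..n}" "a \<in> p i" for a i
    proof -
      have "a \<in> D" using that xs(3) by blast
      then have "a \<in> Obj" "f a \<in> Obj" using f_in D_sub by blast+
      moreover have "(f a, a) \<in> R i" using f[OF \<open>a \<in> D\<close> that(2,3)] by blast
      moreover from this have "(a, f a) \<in> R i"
        using not_strict[OF that] by (simp add: strict_pref_def)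
      ultimately show ?thesis
        using assms(5) that(2)
        unfolding lexicographic_utilities_def consistent_utilities_def by (meson order_antisym)
    qed
    define g where "g a = (if a \<in> set xs then f a else a)" for a
    have "map g xs = map f xs" by (simp add: g_def)
    then have "g permutes set xs"
      using xs by (intro permutes_of_rotate1) (auto simp: g_def)
    then have g: "g permutes Obj"
      using xs(3) D_sub permutes_subset by blast
    \<comment> \<open>In \<open>q\<close> the owner of a cycle object \<open>a\<close> under
      \<open>p\<close> holds \<open>f a\<close>. Applying \<open>h\<close> to the bundles of
      \<open>q\<close> puts \<open>a\<close> back in its place, which undoes the moves along the
      cycle.\<close>
    define h where "h = inv g"
    have h: "h permutes Obj" using g permutes_inv by (auto simp: h_def)
    have hg: "h (g a) = a" and gh: "g (h a) = a" for a
      using permutes_inverses[OF g] by (simp_all add: h_def)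
    define q' where "q' i = h ` q i" for i
    have q': "assignment n Obj q'"
      using assignment_permutes[OF less.prems h] by (simp add: q'_def[abs_def])
    have restored: "a \<in> q' i" if "i \<in> {1..n}" "a \<in> p i" "a \<in> q i \<or> a \<in> set xs" for i a
    proof -
      have "g a \<in> q i"
        using that f xs(3) by (cases "a \<in> set xs") (auto simp: g_def)
      then show ?thesis unfolding q'_def using hg by (metis imageI)
    qed
    have "bundle_utility (u i) (q' i) = bundle_utility (u i) (q i)" if i: "i \<in> {1..n}" for i
    proof -
      \<comment> \<open>If \<open>h b\<close> is on the cycle, then its owner under \<open>p\<close>
        holds \<open>b\<close> in \<open>q\<close>, so that owner is \<open>i\<close>, who is
        indifferent between the two. Otherwise \<open>h\<close> fixes \<open>b\<close>.\<close>
      have "u i (h b) = u i b" if b: "b \<in> q i" for b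
      proof (cases "h b \<in> set xs")
        case True
        then obtain j where j: "j \<in> {1..n}" "h b \<in> p j" using owner by blast
        have "f (h b) = b" using True gh[of b] by (simp add: g_def)
        then have "b \<in> q j" using f[of "h b" j] j True xs(3) by auto
        then have "j = i" using q_unique i j b by blast
        then show ?thesis using indiff[OF True i] j \<open>f (h b) = b\<close> by simp
      next
        case False
        then show ?thesis using gh[of b] by (simp add: g_def)
      qed
      then show ?thesis
        unfolding q'_def bundle_utility_permutes[OF h] by (simp add: bundle_utility_def)
    qed
    then have "pareto_dominates n u q' p"
      using dom by (auto simp: pareto_dominates_def)
    moreover have "card (\<Union>i\<in>{1..n}. p i - q' i) < card D"
    proof (rule psubset_card_mono[OF finD psubsetI])
      show "(\<Union>i\<in>{1..n}. p i - q' i) \<subseteq> D"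
        using restored by (auto simp: D_def)
      \<comment> \<open>Any object of the cycle shows that the decrease is strict: it is lost in
        \<open>q\<close> but back with its owner in \<open>q'\<close>.\<close>
      have "hd xs \<in> D" "hd xs \<in> set xs" using xs by auto
      moreover have "hd xs \<notin> (\<Union>i\<in>{1..n}. p i - q' i)"
        using restored \<open>hd xs \<in> set xs\<close> by blast
      ultimately show "(\<Union>i\<in>{1..n}. p i - q' i) \<noteq> D" by blast
    qed
    ultimately show False using less.hyps q' by (simp add: D_def)
  qed
qed

section \<open>Construction of lexicographic utilities\<close>

text \<open>An object is worth a power of \<open>M\<close> whose exponent counts the objects
  strictly worse than it. All of these have smaller exponents and there are fewer than
  \<open>M\<close> of them, so together they stay below the next power.\<close>

lemma lexicographic_utilities_exist:
  assumes fin: "finite Obj" and pref: "preference_profile n Obj R"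
  obtains u where "lexicographic_utilities n Obj R u"
proof -
  define W where "W i a = {b\<in>Obj. strict_pref (R i) a b}" for i a
  \<comment> \<open>Adding 2 rather than 1 keeps \<open>M > 1\<close> even when there are no
    objects.\<close>
  define M where "M = real (card Obj) + 2"
  define u where "u i a = M ^ card (W i a)" for i a
  have M: "M > 1" by (simp add: M_def)
  have finW: "finite (W i a)" for i a using fin by (simp add: W_def)
  have W_strict: "card (W i b) < card (W i a)"
    if "i \<in> {1..n}" "b \<in> Obj" "strict_pref (R i) a b" for i a b
  proof (rule psubset_card_mono[OF finW psubsetI])
    have "trans (R i)" using pref that(1) by (auto simp: preference_profile_def preorder_on_def)
    then show "W i b \<subseteq> W i a"
      using that by (auto simp: W_def strict_pref_def dest: transD)
    \<comment> \<open>The inclusion is proper because of \<open>b\<close> itself, so a strict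
      preference gives a strictly larger exponent.\<close>
    have "b \<in> W i a" "b \<notin> W i b" using that by (auto simp: W_def strict_pref_def)
    then show "W i b \<noteq> W i a" by blast
  qed
  have W_weak: "card (W i b) \<le> card (W i a)" if "i \<in> {1..n}" "(a, b) \<in> R i" for i a b
  proof (rule card_mono[OF finW])
    have "trans (R i)" using pref that(1) by (auto simp: preference_profile_def preorder_on_def)
    then show "W i b \<subseteq> W i a"
      using that by (auto simp: W_def strict_pref_def dest: transD)
  qed
  have "u i a \<ge> u i b \<longleftrightarrow> (a, b) \<in> R i" if i: "i \<in> {1..n}" and ab: "a \<in> Obj" "b \<in> Obj" for i a b
  proof
    assume "u i a \<ge> u i b"
    then have "\<not> strict_pref (R i) b a"
      using W_strict[OF i ab(1)] M by (force simp: u_def)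
    then show "(a, b) \<in> R i"
      using pref i ab
      unfolding preference_profile_def preorder_on_def refl_on_def total_on_def strict_pref_def
      by metis
  next
    assume "(a, b) \<in> R i"
    then show "u i a \<ge> u i b" using W_weak[OF i] M by (simp add: u_def)
  qed
  then have "consistent_utilities n Obj R u"
    using M by (simp add: consistent_utilities_def u_def)
  moreover have "(\<Sum>b\<in>W i a. u i b) < u i a" if i: "i \<in> {1..n}" "a \<in> Obj" for i a
  proof (cases "W i a = {}")
    case True
    then show ?thesis using M by (simp add: u_def)
  next
    case False
    have "u i b \<le> M ^ (card (W i a) - 1)" if "b \<in> W i a" for b
    proof -
      have "card (W i b) < card (W i a)"
        using W_strict[OF i(1), of b a] that by (simp add: W_def)
      then show ?thesis unfolding u_def using M by (intro power_increasing) auto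
    qed
    then have "(\<Sum>b\<in>W i a. u i b) \<le> real (card (W i a)) * M ^ (card (W i a) - 1)"
      using sum_bounded_above[of "W i a" "u i"] by simp
    also have "\<dots> < M * M ^ (card (W i a) - 1)"
    proof -
      have "card (W i a) \<le> card Obj" using fin by (intro card_mono) (auto simp: W_def)
      then show ?thesis using M by (intro mult_strict_right_mono) (auto simp: M_def)
    qed
    \<comment> \<open>As \<open>W i a\<close> is nonempty, subtracting 1 from its cardinality does
      not truncate, and the extra factor \<open>M\<close> restores the exponent.\<close>
    also have "\<dots> = u i a"
      using False finW[of i a] by (simp add: u_def card_gt_0_iff flip: power_Suc)
    finally show ?thesis .
  qed
  ultimately have "lexicographic_utilities n Obj R u"
    by (simp add: lexicographic_utilities_def W_def)
  then show thesis by (rule that)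
qed

theorem theorem7:
  fixes n :: nat and Obj :: "'a set" and R :: "nat \<Rightarrow> 'a rel" and p :: "nat \<Rightarrow> 'a set"
  assumes "finite Obj"
    and "preference_profile n Obj R"
    and "assignment n Obj p"
  shows "(possibly_pareto_optimal n Obj R p \<longleftrightarrow> \<not> has_strict_cycle n Obj R p) \<and>
    (\<not> has_strict_cycle n Obj R p \<longleftrightarrow>
       (\<forall>u. lexicographic_utilities n Obj R u \<longrightarrow> pareto_optimal n Obj u p)) \<and>
    (\<not> has_strict_cycle n Obj R p \<longleftrightarrow>
       (\<exists>u. lexicographic_utilities n Obj R u \<and> pareto_optimal n Obj u p))"
proof -
  have "\<not> has_strict_cycle n Obj R p" if "possibly_pareto_optimal n Obj R p"
    using that strict_cycle_not_pareto_optimal[OF assms]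
    by (auto simp: possibly_pareto_optimal_def)
  moreover have "\<forall>u. lexicographic_utilities n Obj R u \<longrightarrow> pareto_optimal n Obj u p"
    if "\<not> has_strict_cycle n Obj R p"
    using no_strict_cycle_not_dominated[OF assms that] by (auto simp: pareto_optimal_def)
  \<comment> \<open>Existence lets the universal form of the lexicographic condition imply the
    existential one; as lexicographic profiles are consistent, the latter gives possible Pareto
    optimality and closes the circle.\<close>
  moreover obtain u where "lexicographic_utilities n Obj R u"
    using lexicographic_utilities_exist[OF assms(1,2)] .
  moreover have "possibly_pareto_optimal n Obj R p"
    if "lexicographic_utilities n Obj R u" "pareto_optimal n Obj u p" for u
    using that by (auto simp: possibly_pareto_optimal_def lexicographic_utilities_def)
  ultimately show ?thesis by blast
qed

end
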